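(* Let $n$ be a positive integer. The sum of $\mu_1$ (or $2\mu_1+1$) over all partitions $\mu$ of $n$ into distinct parts equals the sum of $\frac{\lambda_1-1}{2}+l(\lambda)$ (or, respectively, $\lambda_1+2l(\lambda)$) over all partitions $\lambda$ of $n$ into odd parts; namely, $$\sum_{\mu\in D_n}\mu_1=\sum_{\lambda\in O_n}\left(\frac{\lambda_1-1}{2}+l(\lambda)\right),$$ or equivalently, $$\sum_{\mu\in D_n}(2\mu_1+1)=\sum_{\lambda\in O_n}\bigl(\lambda_1+2l(\lambda)\bigr).$$
   Context: A partition $\lambda$ of a positive integer $n$ is a finite nonincreasing sequence of positive integers $\lambda_1,\lambda_2,\ldots,\lambda_r$ with $\sum_i\lambda_i=n$; the $\lambda_i$ are its parts, $\lambda_1$ is its largest part, and $l(\lambda)=r$ is its number of parts (its length). $D_n$ is the set of partitions of $n$ into distinct parts, and $O_n$ is the set of partitions of $n$ into odd parts (repetitions allowed). *)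

theory Defs
  imports Complex_Main
begin

text \<open>A partition is the nonincreasing list of its parts: for a nonempty partition
  \<open>xs\<close>, the largest part is \<open>hd xs\<close> and the number of parts is \<open>length xs\<close>.\<close>

definition is_partition :: "nat \<Rightarrow> nat list \<Rightarrow> bool" where
  "is_partition n xs \<longleftrightarrow>
     sorted_wrt (\<ge>) xs \<and> (\<forall>x\<in>set xs. x > 0) \<and> sum_list xs = n"

definition distinct_partitions :: "nat \<Rightarrow> nat list set" where
  "distinct_partitions n = {xs. is_partition n xs \<and> distinct xs}"

definition odd_partitions :: "nat \<Rightarrow> nat list set" where
  "odd_partitions n = {xs. is_partition n xs \<and> (\<forall>x\<in>set xs. odd x)}"

text \<open>Both sets are finite, so sums over them are genuine finite sums (in HOL, a sum over
  an infinite set is 0).\<close>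

lemma finite_is_partition: "finite {xs. is_partition n xs}"
proof (rule finite_subset)
  have len: "length xs \<le> sum_list xs" if "\<forall>x\<in>set xs. x > 0" for xs :: "nat list"
    using that by (induction xs) auto
  show "{xs. is_partition n xs} \<subseteq> {xs. set xs \<subseteq> {..n} \<and> length xs \<le> n}"
    using len by (auto simp: is_partition_def intro: member_le_sum_list)
  show "finite {xs. set xs \<subseteq> {..n} \<and> length xs \<le> n}"
    by (rule finite_lists_length_le) simp
qed

lemma finite_distinct_partitions: "finite (distinct_partitions n)"
  by (rule finite_subset[OF _ finite_is_partition[of n]]) (auto simp: distinct_partitions_def)

lemma finite_odd_partitions: "finite (odd_partitions n)"
  by (rule finite_subset[OF _ finite_is_partition[of n]]) (auto simp: odd_partitions_def)

end

theory Submission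
  imports Defs
begin

text \<open>The identity holds term by term: Sylvester's bijection between partitions into distinct
  parts and partitions into odd parts turns \<open>2 * hd \<mu> + 1\<close> into
  \<open>hd \<lambda> + 2 * length \<lambda>\<close> (a refinement of Euler's theorem due to Fine).

  Write the parts of an odd partition as \<open>2 * m\<^sub>i + 1\<close> and draw them as centred rows, with
  \<open>m\<^sub>i\<close> cells on each side of a central column. Cut the diagram into hooks. The first hook
  is the central column together with the right half of the first row; it has
  \<open>a = length \<lambda> + m\<^sub>1\<close> cells, and this is the largest part of the distinct partition, whence
  the equality of the two statistics. The second hook is the left half of the first row together
  with what remains of the column immediately to the left of the centre; it has \<open>b = m\<^sub>1 + r\<close>
  cells, where \<open>r\<close> counts the rows \<open>i > 1\<close> with \<open>m\<^sub>i \<ge> 1\<close>. Without these two hooks, each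
  of those \<open>r\<close> rows has lost two cells, so the rest is again the diagram of an odd partition,
  now with \<open>r\<close> parts, and the cutting continues.

  Reading this backwards gives a recursion on the distinct partition \<open>a, b, \<dots>\<close>: build the odd
  partition of the remaining parts; its length is \<open>r\<close>, so \<open>m\<^sub>1 = b - r\<close>; widen its rows by
  two, put the row \<open>2 * m\<^sub>1 + 1\<close> on top and add \<open>a - b - 1\<close> rows of one cell.
  The statistic identity for the remaining parts is exactly what makes the new top row the
  longest, so \<open>sylvester_wf\<close> proves both together. Injectivity and surjectivity hold because the
  rows longer than one cell, other than the first, recover the smaller odd partition.\<close>

definition strict_parts :: "nat list \<Rightarrow> bool" where
  "strict_parts ms \<longleftrightarrow> sorted_wrt (>) ms \<and> (\<forall>x\<in>set ms. x > 0)"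

definition odd_parts :: "nat list \<Rightarrow> bool" where
  "odd_parts ls \<longleftrightarrow> sorted_wrt (\<ge>) ls \<and> (\<forall>x\<in>set ls. odd x)"

text \<open>Two hooks per step, hence two parts. A lone part \<open>a\<close> is the case where the diagram is a
  single column, so that there is no second hook.\<close>

fun sylvester :: "nat list \<Rightarrow> nat list" where
  "sylvester [] = []"
| "sylvester [a] = replicate a 1"
| "sylvester (a # b # ms) =
     (2 * (b - length (sylvester ms)) + 1) #
       map (\<lambda>x. x + 2) (sylvester ms) @ replicate (a - b - 1) 1"

lemma distinct_partitions_eq: "distinct_partitions n = {ms. strict_parts ms \<and> sum_list ms = n}"
proof -
  have "sorted_wrt (\<ge>) ms \<and> distinct ms \<longleftrightarrow> sorted_wrt (>) ms" for ms :: "nat list"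
    by (induction ms) (auto simp: order.strict_iff_order)
  then show ?thesis
    by (auto simp: distinct_partitions_def strict_parts_def is_partition_def)
qed

lemma odd_partitions_eq: "odd_partitions n = {ls. odd_parts ls \<and> sum_list ls = n}"
  by (auto simp: odd_partitions_def odd_parts_def is_partition_def odd_pos)

lemma sum_list_map_add_const: "sum_list (map (\<lambda>x. x + c) xs) = sum_list xs + length xs * (c::nat)"
  by (induction xs) auto

text \<open>The two claims need each other. The statistic identity for the parts below \<open>b\<close>
  bounds the length and the largest row of their image in terms of \<open>b\<close>, so that the truncated
  subtraction in the definition is a true one and the new first row is long enough.\<close>

lemma sylvester_wf:
  assumes "strict_parts ms"
  shows "odd_parts (sylvester ms) \<and> sum_list (sylvester ms) = sum_list ms \<and>
    (ms \<noteq> [] \<longrightarrow> sylvester ms \<noteq> [] \<and>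
       hd (sylvester ms) + 2 * length (sylvester ms) = 2 * hd ms + 1)"
  using assms
proof (induction ms rule: sylvester.induct)
  case 1
  then show ?case by (simp add: odd_parts_def)
next
  case (2 a)
  then show ?case
    by (auto simp: odd_parts_def strict_parts_def sum_list_replicate sorted_wrt_iff_nth_less)
next
  case (3 a b ms)
  define ls where "ls = sylvester ms"
  have ab: "b < a" "b > 0" and ms: "strict_parts ms" and lt: "\<forall>x\<in>set ms. x < b"
    using "3.prems" by (auto simp: strict_parts_def)
  have ls: "odd_parts ls" "sum_list ls = sum_list ms"
    "ms \<noteq> [] \<Longrightarrow> ls \<noteq> [] \<and> hd ls + 2 * length ls = 2 * hd ms + 1"
    using "3.IH"(1)[OF ms] by (auto simp: ls_def)
  have empty: "ms = [] \<Longrightarrow> ls = []"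
    by (simp add: ls_def)
  have room: "hd ls + 2 * length ls < 2 * b" if "ls \<noteq> []"
  proof -
    have "ms \<noteq> []" using that empty by auto
    then show ?thesis using ls(3) lt hd_in_set[of ms] by fastforce
  qed
  have len: "length ls < b"
    using room ab by (cases "ls = []") auto
  have hd_max: "y \<le> hd ls" if "y \<in> set ls" for y
    using that ls(1) by (cases ls) (auto simp: odd_parts_def)
  have top: "y + 2 \<le> 2 * (b - length ls) + 1" if "y \<in> set ls" for y
  proof -
    have "ls \<noteq> []" using that by auto
    then show ?thesis using room hd_max[OF that] len by linarith
  qed
  have "odd_parts (sylvester (a # b # ms))"
    using ls(1) top unfolding odd_parts_def sylvester.simps ls_def[symmetric]
    by (auto simp: sorted_wrt_append sorted_wrt_map sorted_wrt_iff_nth_less[of _ "replicate _ _"])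
  then show ?case
    using ab len ls(2) sum_list_map_add_const[of 2 ls]
    by (auto simp: ls_def[symmetric] sum_list_replicate)
qed

lemma length_sylvester_less:
  assumes "strict_parts (a # b # ms)"
  shows "length (sylvester ms) < b"
proof (cases "ms = []")
  case False
  have "strict_parts ms" "hd ms < b"
    using assms False by (auto simp: strict_parts_def)
  then show ?thesis using sylvester_wf[of ms] False by auto
qed (use assms in \<open>auto simp: strict_parts_def\<close>)

lemma sylvester_inj:
  assumes "strict_parts ms" "strict_parts ms'" "sylvester ms = sylvester ms'"
  shows "ms = ms'"
  using assms
proof (induction ms arbitrary: ms' rule: sylvester.induct)
  case 1
  then show ?case using sylvester_wf[of ms'] by auto
next
  case (2 a)
  show ?case
  proof (cases ms' rule: sylvester.cases)
    case (3 a' b' ns)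
    \<comment> \<open>Only a partition with at least two parts has an image with first row longer than 1.\<close>
    have "length (sylvester ns) < b'"
      using 2 3 length_sylvester_less by blast
    then show ?thesis using 2 3 by (cases a) (auto simp: strict_parts_def)
  qed (use 2 in \<open>auto simp: strict_parts_def dest: arg_cong[where f = length]\<close>)
next
  case (3 a b ms)
  note len = length_sylvester_less[OF "3.prems"(1)]
  have ab: "b < a" and ms: "strict_parts ms"
    using "3.prems"(1) by (auto simp: strict_parts_def)
  show ?case
  proof (cases ms' rule: sylvester.cases)
    case 1
    then show ?thesis using 3 by simp
  next
    case (2 a')
    then show ?thesis using 3 len by (cases a') auto
  next
    case (3 a' b' ns)
    have len': "length (sylvester ns) < b'" and ab': "b' < a'" and ns: "strict_parts ns"
      using "3.prems"(2) 3 length_sylvester_less by (auto simp: strict_parts_def)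
    note eq = "3.prems"(3)[unfolded 3 sylvester.simps]
    \<comment> \<open>The widened rows are longer than one cell, the rows added below them are not.\<close>
    have "filter (\<lambda>x. x > 1) (tl (sylvester (a # b # ms))) = map (\<lambda>x. x + 2) (sylvester ms)"
      for a b ms by (simp add: filter_map o_def)
    then have "map (\<lambda>x. x + 2) (sylvester ms) = map (\<lambda>x. x + 2) (sylvester ns)"
      using "3.prems"(3) 3 by metis
    then have same: "sylvester ms = sylvester ns"
      by (simp add: inj_map_eq_map inj_def)
    then have "ms = ns"
      using "3.IH" ms ns by blast
    moreover have "b = b'"
      using eq same len len' by auto
    moreover have "a = a'"
      using arg_cong[OF eq, of length] same ab ab' \<open>b = b'\<close> by simp
    ultimately show ?thesis using 3 by simp
  qed
qed

text \<open>In a weakly decreasing list the entries equal to 1 come last.\<close>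

lemma odd_parts_split_ones:
  assumes "odd_parts ls"
  shows "ls = filter (\<lambda>x. x > 1) ls @ replicate (length (filter (\<lambda>x. \<not> x > 1) ls)) 1"
  using assms
proof (induction ls)
  case (Cons x xs)
  have IH: "xs = filter (\<lambda>x. x > 1) xs @ replicate (length (filter (\<lambda>x. \<not> x > 1) xs)) 1"
    using Cons by (simp add: odd_parts_def)
  show ?case
  proof (cases "x > 1")
    case True
    then show ?thesis using IH by simp
  next
    case False
    then have "x = 1" using Cons(2) by (auto simp: odd_parts_def not_less le_Suc_eq)
    then have "filter (\<lambda>x. x > 1) xs = []"
      using Cons(2) by (auto simp: odd_parts_def filter_empty_conv)
    then show ?thesis using \<open>x = 1\<close> IH by simp
  qed
qed simp

text \<open>Undoing one step of the recursion leaves a shorter odd partition. That the two recovered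
  parts exceed the parts of its preimage is again the statistic identity in \<open>sylvester_wf\<close>.\<close>

lemma sylvester_surj:
  assumes "odd_parts ls"
  shows "\<exists>ms. strict_parts ms \<and> sylvester ms = ls"
  using assms
proof (induction "length ls" arbitrary: ls rule: less_induct)
  case less
  show ?case
  proof (cases ls)
    case Nil
    then show ?thesis by (intro exI[of _ "[]"]) (simp add: strict_parts_def)
  next
    case (Cons x xs)
    have x: "odd x" "\<forall>y\<in>set xs. y \<le> x" and xs: "odd_parts xs"
      using less(2) Cons by (auto simp: odd_parts_def)
    show ?thesis
    proof (cases "x = 1")
      case True
      then have "filter (\<lambda>y. y > 1) ls = []"
        using x Cons by (auto simp: filter_empty_conv)
      then have "ls = replicate (length ls) 1"
        using odd_parts_split_ones[OF less(2)] by (metis append_Nil length_replicate)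
      then show ?thesis
        using Cons by (intro exI[of _ "[length ls]"]) (auto simp: strict_parts_def)
    next
      case False
      define big where "big = filter (\<lambda>y. y > 1) xs"
      define k where "k = length (filter (\<lambda>y. \<not> y > 1) xs)"
      define rs where "rs = map (\<lambda>y. y - 2) big"
      obtain m where m: "x = 2 * m + 1" "m > 0"
        using x(1) False by (auto elim!: oddE)
      have xs_eq: "xs = big @ replicate k 1"
        using odd_parts_split_ones[OF xs] by (simp add: big_def k_def)
      have big3: "odd y \<and> 3 \<le> y \<and> y \<le> x" if "y \<in> set big" for y
      proof -
        have "odd y" "y > 1" "y \<le> x"
          using that xs x by (auto simp: big_def odd_parts_def)
        then show ?thesis by (cases "y = 2") auto
      qed
      have "sorted_wrt (\<ge>) big"
        using xs by (simp add: big_def odd_parts_def sorted_wrt_filter)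
      then have rs: "odd_parts rs"
        using big3 unfolding odd_parts_def rs_def sorted_wrt_map
        by (fastforce elim!: sorted_wrt_mono_rel[rotated] intro: diff_le_mono)
      have big_eq: "map (\<lambda>y. y + 2) rs = big"
        unfolding rs_def map_map using big3 by (intro map_idI) fastforce
      have "length rs < length ls"
        using Cons by (simp add: rs_def big_def less_Suc_eq_le)
      from less(1)[OF this rs] obtain ms where ms: "strict_parts ms" "sylvester ms = rs"
        by blast
      \<comment> \<open>Cells of the second and of the first hook; the central column has
        \<open>1 + length rs + k\<close> rows.\<close>
      define b where "b = m + length rs"
      define a where "a = b + 1 + k"
      have "y < b" if "y \<in> set ms" for y
      proof -
        have "ms \<noteq> []" using that by auto
        then have rs_hd: "rs \<noteq> []" "hd rs + 2 * length rs = 2 * hd ms + 1"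
          using sylvester_wf[OF ms(1)] ms(2) by auto
        have "hd rs + 2 \<le> x"
          using rs_hd(1) big3[of "hd big"] by (cases big) (auto simp: rs_def)
        moreover have "y \<le> hd ms"
          using that ms(1) by (cases ms) (auto simp: strict_parts_def)
        ultimately show ?thesis using rs_hd(2) m by (simp add: b_def)
      qed
      then have "strict_parts (a # b # ms)"
        using ms(1) m(2) by (force simp: strict_parts_def a_def b_def)
      moreover have "sylvester (a # b # ms) = ls"
        using ms(2) big_eq xs_eq m Cons by (simp add: a_def b_def)
      ultimately show ?thesis by blast
    qed
  qed
qed

lemma sylvester_bij: "bij_betw sylvester (distinct_partitions n) (odd_partitions n)"
  unfolding bij_betw_def distinct_partitions_eq odd_partitions_eq
proof
  show "inj_on sylvester {ms. strict_parts ms \<and> sum_list ms = n}"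
    by (auto intro!: inj_onI dest: sylvester_inj)
  show "sylvester ` {ms. strict_parts ms \<and> sum_list ms = n} = {ls. odd_parts ls \<and> sum_list ls = n}"
    using sylvester_wf sylvester_surj by (fastforce simp: image_iff)
qed

theorem theorem2p1:
  fixes n :: nat
  assumes "n > 0"
  shows "(\<Sum>ms\<in>distinct_partitions n. real (hd ms)) =
           (\<Sum>ls\<in>odd_partitions n. (real (hd ls) - 1) / 2 + real (length ls)) \<and>
         (\<Sum>ms\<in>distinct_partitions n. 2 * hd ms + 1) =
           (\<Sum>ls\<in>odd_partitions n. hd ls + 2 * length ls)"
proof -
  have stat: "2 * hd ms + 1 = hd (sylvester ms) + 2 * length (sylvester ms)"
    if "ms \<in> distinct_partitions n" for ms
    using that assms sylvester_wf[of ms] by (auto simp: distinct_partitions_eq)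
  have real_stat: "real (hd ms) = (real (hd (sylvester ms)) - 1) / 2 + real (length (sylvester ms))"
    if "ms \<in> distinct_partitions n" for ms
    using arg_cong[OF stat[OF that], of real] by (simp add: field_simps)
  show ?thesis
    unfolding sum.reindex_bij_betw[OF sylvester_bij, symmetric]
    using stat real_stat by (intro conjI sum.cong refl)
qed

end
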